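(* Let $a_0,a_1$ be two masks. If the adaptive directional subdivision scheme based on $a_0,a_1$ converges, then the limit functions $f_\varepsilon$, $\varepsilon=(\varepsilon_1,\varepsilon_2,\dots)\in E_\infty$, satisfy the refinement equation $$f_\varepsilon=\sum_{\alpha\in\mathbb{Z}^2}a_{\varepsilon_1}(\alpha)\,f_{\widehat\varepsilon}(W_{\varepsilon_1}\cdot-\alpha),\qquad \widehat\varepsilon:=(\varepsilon_2,\varepsilon_3,\dots).$$
   Context: Let $W_0=\begin{pmatrix}4&0\\0&2\end{pmatrix}$, $W_1=\begin{pmatrix}4&-4\\0&2\end{pmatrix}$, and $W_\varepsilon=W_{\varepsilon_n}\cdots W_{\varepsilon_1}$ for $\varepsilon\in\{0,1\}^n$. A mask is a finitely supported real sequence on $\mathbb{Z}^2$. For $\eta\in\{0,1\}$ let $(S_\eta c)(\alpha)=\sum_{\beta\in\mathbb{Z}^2}a_\eta(\alpha-W_\eta\beta)c(\beta)$, and $S_\varepsilon=S_{\varepsilon_n}\cdots S_{\varepsilon_1}$ for $\varepsilon\in\{0,1\}^n$. Let $E_\infty=\{0,1\}^{\mathbb{N}}$ with $\mathbb N=\{1,2,\dots\}$, $P_n\varepsilon=(\varepsilon_1,\dots,\varepsilon_n)$, and $\delta(\alpha)=1$ if $\alpha=0$ and $0$ otherwise. The adaptive directional subdivision scheme based on $a_0,a_1$ converges if for every $\varepsilon\in E_\infty$ there is a nonzero uniformly continuous function $f_\varepsilon:\mathbb{R}^2\to\mathbb{R}$ (the limit function) with $\lim_{n\to\infty}\sup_{\alpha\in\mathbb{Z}^2}|f_\varepsilon(W_{P_n\varepsilon}^{-1}\alpha)-S_{P_n\varepsilon}\delta(\alpha)|=0$.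 *)

theory Defs
  imports "HOL-Analysis.Analysis" "HOL-Library.Stream" "HOL-Library.Z2"
begin

text \<open>
  The digits \<open>\<eta> \<in> {0,1}\<close> are elements of type \<^typ>\<open>bit\<close>, the finite words
  \<open>\<epsilon> \<in> {0,1}\<^sup>n\<close> are lists, and the elements of \<open>E\<^sub>\<infinity>\<close> are streams.  For
  \<open>\<epsilon> = (\<epsilon>\<^sub>1, \<epsilon>\<^sub>2, \<dots>)\<close> one has \<open>shd \<epsilon> = \<epsilon>\<^sub>1\<close>, \<open>stl \<epsilon> = (\<epsilon>\<^sub>2, \<epsilon>\<^sub>3, \<dots>)\<close> and
  \<open>stake n \<epsilon> = (\<epsilon>\<^sub>1, \<dots>, \<epsilon>\<^sub>n)\<close>.  The lattice of integer points is the type \<open>int ^ 2\<close>.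
\<close>

text \<open>
  The dilation matrices are polymorphic, so that the same matrix acts on \<open>int ^ 2\<close> and on
  \<open>real ^ 2\<close>.
\<close>

definition W :: "bit \<Rightarrow> 'a::comm_ring_1 ^ 2 ^ 2" where
  "W \<eta> = (if \<eta> = 0 then vector [vector [4, 0], vector [0, 2]]
                     else vector [vector [4, -4], vector [0, 2]])"

text \<open>The first letter of the word is the rightmost factor, hence acts first.\<close>

fun W_word :: "bit list \<Rightarrow> 'a::comm_ring_1 ^ 2 ^ 2" where
  "W_word [] = mat 1"
| "W_word (\<eta> # \<epsilon>) = W_word \<epsilon> ** W \<eta>"

definition real_vec :: "int ^ 2 \<Rightarrow> real ^ 2" where
  "real_vec \<alpha> = (\<chi> i. of_int (\<alpha> $ i))"

definition is_mask :: "(int ^ 2 \<Rightarrow> real) \<Rightarrow> bool" where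
  "is_mask c \<longleftrightarrow> finite {\<alpha>. c \<alpha> \<noteq> 0}"

text \<open>
  If \<open>a \<eta>\<close> is a mask, the sum has only finitely many nonzero terms for every sequence \<open>c\<close>,
  because \<open>W \<eta>\<close> is injective.
\<close>

definition subdiv :: "(bit \<Rightarrow> int ^ 2 \<Rightarrow> real) \<Rightarrow> bit \<Rightarrow> (int ^ 2 \<Rightarrow> real) \<Rightarrow> int ^ 2 \<Rightarrow> real" where
  "subdiv a \<eta> c \<alpha> = (\<Sum>\<^sub>\<infinity>\<beta>\<in>UNIV. a \<eta> (\<alpha> - W \<eta> *v \<beta>) * c \<beta>)"

fun subdiv_word ::
  "(bit \<Rightarrow> int ^ 2 \<Rightarrow> real) \<Rightarrow> bit list \<Rightarrow> (int ^ 2 \<Rightarrow> real) \<Rightarrow> int ^ 2 \<Rightarrow> real" where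
  "subdiv_word a [] c = c"
| "subdiv_word a (\<eta> # \<epsilon>) c = subdiv_word a \<epsilon> (subdiv a \<eta> c)"

definition delta :: "int ^ 2 \<Rightarrow> real" where
  "delta \<alpha> = (if \<alpha> = 0 then 1 else 0)"

text \<open>The supremum is taken in \<^typ>\<open>ereal\<close>, so that it is \<open>\<infinity>\<close> for an unbounded difference.\<close>

definition limit_function ::
  "(bit \<Rightarrow> int ^ 2 \<Rightarrow> real) \<Rightarrow> bit stream \<Rightarrow> (real ^ 2 \<Rightarrow> real) \<Rightarrow> bool" where
  "limit_function a \<epsilon> f \<longleftrightarrow>
     f \<noteq> (\<lambda>x. 0) \<and> uniformly_continuous_on UNIV f \<and>
     (\<lambda>n. SUP \<alpha>. ereal \<bar>f (matrix_inv (W_word (stake n \<epsilon>)) *v real_vec \<alpha>)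
                          - subdiv_word a (stake n \<epsilon>) delta \<alpha>\<bar>) \<longlonglongrightarrow> 0"

definition scheme_converges :: "(bit \<Rightarrow> int ^ 2 \<Rightarrow> real) \<Rightarrow> bool" where
  "scheme_converges a \<longleftrightarrow> (\<forall>\<epsilon>. \<exists>f. limit_function a \<epsilon> f)"

end

theory Submission
  imports Defs
begin

text \<open>
  Write \<open>\<epsilon> = (\<eta>, \<epsilon>')\<close>.  One subdivision step turns \<open>\<delta>\<close> into the mask \<open>a \<eta>\<close>, which is the
  finite combination \<open>\<Sum>\<beta>. a \<eta> \<beta> \<cdot> \<delta>(\<cdot> - \<beta>)\<close> of shifted deltas.  Subdivision is linear and
  carries a shift by \<open>\<beta>\<close> to a shift by \<open>W\<^sub>w \<beta>\<close>, so for every word \<open>w\<close>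
  \<open>S\<^bsub>\<eta>w\<^esub> \<delta> (\<alpha>) = \<Sum>\<beta>. a \<eta> \<beta> \<cdot> S\<^sub>w \<delta> (\<alpha> - W\<^sub>w \<beta>)\<close>.
  This is the refinement equation on the level of the sequences produced by the scheme.  At the
  point \<open>x\<^sub>\<alpha> = W\<^bsub>\<eta>w\<^esub>\<^sup>-\<^sup>1 \<alpha>\<close> the left-hand side approximates \<open>f \<epsilon> x\<^sub>\<alpha>\<close>, and since
  \<open>W\<^sub>w\<^sup>-\<^sup>1 (\<alpha> - W\<^sub>w \<beta>) = W\<^sub>\<eta> x\<^sub>\<alpha> - \<beta>\<close>, the terms on the right-hand side approximate
  \<open>f \<epsilon>' (W\<^sub>\<eta> x\<^sub>\<alpha> - \<beta>)\<close>.

  It remains to pass from the points \<open>x\<^sub>\<alpha>\<close> to an arbitrary point \<open>x\<close>.  In the norm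
  \<open>max \<bar>v\<^sub>1\<bar> (2\<bar>v\<^sub>2\<bar>)\<close> both dilations expand by a factor of at least two, so the refined lattices
  \<open>W\<^sub>w\<^sup>-\<^sup>1 \<int>\<^sup>2\<close> have mesh size tending to zero with the length of \<open>w\<close>.  Hence \<open>x\<close> is a limit of
  lattice points, and continuity of the limit functions yields the equation at \<open>x\<close>.
\<close>

section \<open>Expansion by the dilation matrices\<close>

text \<open>
  The weight 2 on the second coordinate absorbs the shear in \<open>W 1\<close>: both dilations expand this
  norm by the full factor 2.  In the plain supremum norm, \<open>W 1\<close> maps \<open>(1, 2/3)\<close> to
  \<open>(4/3, 4/3)\<close> and expands by 4/3 only.
\<close>

definition weighted_norm :: "real ^ 2 \<Rightarrow> real" where
  "weighted_norm v = max \<bar>v $ 1\<bar> (2 * \<bar>v $ 2\<bar>)"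

lemma W_mult_nth:
  "(W \<eta> *v v) $ 1 = (if \<eta> = 0 then 4 * v $ 1 else 4 * v $ 1 - 4 * v $ 2)"
  "(W \<eta> *v v) $ 2 = 2 * v $ 2"
  by (simp_all add: W_def matrix_vector_mult_def sum_2)

lemma weighted_norm_W: "weighted_norm (W \<eta> *v v) \<ge> 2 * weighted_norm v"
proof -
  have "2 * \<bar>v $ 1\<bar> \<le> \<bar>(W \<eta> *v v) $ 1\<bar> \<or> \<bar>v $ 1\<bar> \<le> 2 * \<bar>v $ 2\<bar>"
    unfolding W_mult_nth(1) by (cases "\<eta> = 0"; simp; linarith)
  moreover have "\<bar>(W \<eta> *v v) $ 2\<bar> = 2 * \<bar>v $ 2\<bar>"
    by (simp add: W_mult_nth(2) abs_mult)
  ultimately show ?thesis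
    unfolding weighted_norm_def by (auto simp: le_max_iff_disj max_def)
qed

lemma weighted_norm_W_word:
  "weighted_norm (W_word w *v v) \<ge> 2 ^ length w * weighted_norm v"
proof (induction w arbitrary: v)
  case Nil
  show ?case by simp
next
  case (Cons \<eta> w)
  have "2 ^ length (\<eta> # w) * weighted_norm v = 2 ^ length w * (2 * weighted_norm v)" by simp
  also have "\<dots> \<le> 2 ^ length w * weighted_norm (W \<eta> *v v)"
    by (intro mult_left_mono weighted_norm_W) simp
  also have "\<dots> \<le> weighted_norm (W_word w *v (W \<eta> *v v))" by (rule Cons.IH)
  finally show ?case by (simp add: matrix_vector_mul_assoc)
qed

lemma norm_le_weighted_norm: "norm v \<le> 2 * weighted_norm v"
  using norm_le_l1_cart[of v] unfolding weighted_norm_def sum_2 by linarith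

lemma W_word_inverse:
  "matrix_inv (W_word w :: real ^ 2 ^ 2) ** W_word w = mat 1"
  "W_word w ** matrix_inv (W_word w :: real ^ 2 ^ 2) = mat 1"
proof -
  have "v = 0" if "(W_word w :: real ^ 2 ^ 2) *v v = 0" for v
  proof -
    have "2 ^ length w * weighted_norm v \<le> 0"
      using weighted_norm_W_word[of w v] that by (simp add: weighted_norm_def)
    then have "weighted_norm v \<le> 0" by (simp add: mult_le_0_iff power_le_zero_eq)
    then have "norm v \<le> 0" using norm_le_weighted_norm[of v] by linarith
    then show "v = 0" by simp
  qed
  then have "invertible (W_word w :: real ^ 2 ^ 2)"
    using matrix_left_invertible_ker invertible_left_inverse by blast
  then show "matrix_inv (W_word w :: real ^ 2 ^ 2) ** W_word w = mat 1"
    and "W_word w ** matrix_inv (W_word w :: real ^ 2 ^ 2) = mat 1"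
    unfolding invertible_def matrix_inv_def by (metis (mono_tags, lifting) someI_ex)+
qed

lemma real_vec_W: "real_vec (W \<eta> *v \<beta>) = W \<eta> *v real_vec \<beta>"
  by (simp add: vec_eq_iff forall_2 W_mult_nth real_vec_def)

lemma real_vec_W_word: "real_vec (W_word w *v \<beta>) = W_word w *v real_vec \<beta>"
proof (induction w arbitrary: \<beta>)
  case Nil
  show ?case by simp
next
  case (Cons \<eta> w)
  have "real_vec (W_word (\<eta> # w) *v \<beta>) = real_vec (W_word w *v (W \<eta> *v \<beta>))"
    by (simp only: matrix_vector_mul_assoc W_word.simps)
  also have "\<dots> = W_word w *v (W \<eta> *v real_vec \<beta>)"
    by (simp only: Cons.IH real_vec_W)
  also have "\<dots> = W_word (\<eta> # w) *v real_vec \<beta>"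
    by (simp only: matrix_vector_mul_assoc W_word.simps)
  finally show ?case .
qed

lemma real_vec_diff: "real_vec (\<alpha> - \<beta>) = real_vec \<alpha> - real_vec \<beta>"
  by (simp add: vec_eq_iff real_vec_def)

definition floor_vec :: "real ^ 2 \<Rightarrow> int ^ 2" where
  "floor_vec v = (\<chi> i. \<lfloor>v $ i\<rfloor>)"

text \<open>
  Rounding in the dilated coordinates costs a bounded error, which the expansion turns into a
  geometrically small one in the original coordinates.
\<close>

lemma lattice_approximation:
  "(\<lambda>n. matrix_inv (W_word (stake n \<epsilon>)) *v real_vec (floor_vec (W_word (stake n \<epsilon>) *v x)))
     \<longlonglongrightarrow> x"
proof -
  let ?M = "\<lambda>n. W_word (stake n \<epsilon>) :: real ^ 2 ^ 2"
  let ?y = "\<lambda>n. matrix_inv (?M n) *v real_vec (floor_vec (?M n *v x))"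
  have bound: "norm (?y n - x) \<le> 4 * (1 / 2) ^ n" for n
  proof -
    let ?u = "real_vec (floor_vec (?M n *v x)) - ?M n *v x"
    have "?M n *v (?y n - x) = ?u"
      by (simp add: matrix_vector_mult_diff_distrib matrix_vector_mul_assoc W_word_inverse)
    then have "2 ^ n * weighted_norm (?y n - x) \<le> weighted_norm ?u"
      using weighted_norm_W_word[of "stake n \<epsilon>" "?y n - x"] by simp
    also have "\<dots> \<le> 2"
    proof -
      have "\<bar>?u $ i\<bar> \<le> 1" for i
        unfolding real_vec_def floor_vec_def by simp linarith
      from this[of 1] this[of 2] show ?thesis
        unfolding weighted_norm_def by linarith
    qed
    finally have "weighted_norm (?y n - x) \<le> 2 * (1 / 2) ^ n"
      by (simp add: field_simps power_one_over)
    then show ?thesis using norm_le_weighted_norm[of "?y n - x"] by simp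
  qed
  have "(\<lambda>n. 4 * (1 / 2) ^ n :: real) \<longlonglongrightarrow> 0"
    by (intro tendsto_mult_right_zero LIMSEQ_power_zero) simp
  with always_eventually[OF allI[OF bound]] have "(\<lambda>n. ?y n - x) \<longlonglongrightarrow> 0"
    by (rule Lim_null_comparison)
  then show ?thesis by (rule LIM_zero_cancel)
qed

section \<open>Subdivision of combinations of shifted sequences\<close>

lemma subdiv_shift:
  "subdiv a \<eta> (\<lambda>\<gamma>. c (\<gamma> - \<beta>)) = (\<lambda>\<alpha>. subdiv a \<eta> c (\<alpha> - W \<eta> *v \<beta>))"
proof
  fix \<alpha>
  have "bij (\<lambda>\<gamma>. \<gamma> + \<beta>)"
    by (rule bij_betw_byWitness[where f' = "\<lambda>\<gamma>. \<gamma> - \<beta>"]) auto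
  from infsum_reindex_bij_betw[OF this, of "\<lambda>\<gamma>. a \<eta> (\<alpha> - W \<eta> *v \<gamma>) * c (\<gamma> - \<beta>)"]
  show "subdiv a \<eta> (\<lambda>\<gamma>. c (\<gamma> - \<beta>)) \<alpha> = subdiv a \<eta> c (\<alpha> - W \<eta> *v \<beta>)"
    by (simp add: subdiv_def matrix_vector_right_distrib algebra_simps)
qed

lemma subdiv_word_shift:
  "subdiv_word a w (\<lambda>\<gamma>. c (\<gamma> - \<beta>)) = (\<lambda>\<alpha>. subdiv_word a w c (\<alpha> - W_word w *v \<beta>))"
proof (induction w arbitrary: c \<beta>)
  case Nil
  show ?case by simp
next
  case (Cons \<eta> w)
  show ?case
    by (simp only: subdiv_word.simps W_word.simps subdiv_shift[of a \<eta> c \<beta>]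
        Cons.IH[of "subdiv a \<eta> c" "W \<eta> *v \<beta>"] matrix_vector_mul_assoc)
qed

lemma W_int_inj:
  assumes "W \<eta> *v \<beta> = W \<eta> *v (\<gamma> :: int ^ 2)"
  shows "\<beta> = \<gamma>"
proof -
  have "(W \<eta> *v \<beta>) $ 1 = (W \<eta> *v \<gamma>) $ 1" "(W \<eta> *v \<beta>) $ 2 = (W \<eta> *v \<gamma>) $ 2"
    using assms by simp_all
  then show ?thesis by (simp add: W_mult_nth vec_eq_iff forall_2 split: if_splits)
qed

lemma subdiv_summable:
  assumes "is_mask (a \<eta>)"
  shows "(\<lambda>\<beta>. a \<eta> (\<alpha> - W \<eta> *v \<beta>) * c \<beta>) summable_on UNIV"
proof -
  have "finite ((\<lambda>\<beta>. \<alpha> - W \<eta> *v \<beta>) -` {\<gamma>. a \<eta> \<gamma> \<noteq> 0})"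
    using assms unfolding is_mask_def
    by (rule finite_vimageI) (auto intro!: injI dest: W_int_inj)
  then have "(\<lambda>\<beta>. a \<eta> (\<alpha> - W \<eta> *v \<beta>) * c \<beta>) summable_on
      ((\<lambda>\<beta>. \<alpha> - W \<eta> *v \<beta>) -` {\<gamma>. a \<eta> \<gamma> \<noteq> 0})"
    by (rule summable_on_finite)
  then show ?thesis
    by (rule summable_on_cong_neutral[THEN iffD1, rotated -1]) auto
qed

lemma has_sum_sum:
  fixes f :: "'b \<Rightarrow> 'a \<Rightarrow> 'c::topological_comm_monoid_add"
  assumes "\<And>i. i \<in> I \<Longrightarrow> (f i has_sum s i) A"
  shows "((\<lambda>x. \<Sum>i\<in>I. f i x) has_sum (\<Sum>i\<in>I. s i)) A"
  using assms by (induction I rule: infinite_finite_induct) (simp_all add: has_sum_add)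

lemma subdiv_sum:
  assumes "is_mask (a \<eta>)"
  shows "subdiv a \<eta> (\<lambda>\<gamma>. \<Sum>\<beta>\<in>B. k \<beta> * d \<beta> \<gamma>) = (\<lambda>\<alpha>. \<Sum>\<beta>\<in>B. k \<beta> * subdiv a \<eta> (d \<beta>) \<alpha>)"
proof
  fix \<alpha>
  have "((\<lambda>\<gamma>. \<Sum>\<beta>\<in>B. k \<beta> * (a \<eta> (\<alpha> - W \<eta> *v \<gamma>) * d \<beta> \<gamma>)) has_sum
      (\<Sum>\<beta>\<in>B. k \<beta> * subdiv a \<eta> (d \<beta>) \<alpha>)) UNIV"
    unfolding subdiv_def
    by (intro has_sum_sum has_sum_cmult_right has_sum_infsum subdiv_summable assms)
  moreover have "(\<Sum>\<beta>\<in>B. k \<beta> * (a \<eta> (\<alpha> - W \<eta> *v \<gamma>) * d \<beta> \<gamma>)) =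
      a \<eta> (\<alpha> - W \<eta> *v \<gamma>) * (\<Sum>\<beta>\<in>B. k \<beta> * d \<beta> \<gamma>)" for \<gamma>
    by (simp add: sum_distrib_left mult_ac)
  ultimately show "subdiv a \<eta> (\<lambda>\<gamma>. \<Sum>\<beta>\<in>B. k \<beta> * d \<beta> \<gamma>) \<alpha> =
      (\<Sum>\<beta>\<in>B. k \<beta> * subdiv a \<eta> (d \<beta>) \<alpha>)"
    unfolding subdiv_def[of a \<eta> "\<lambda>\<gamma>. \<Sum>\<beta>\<in>B. k \<beta> * d \<beta> \<gamma>"] by (simp add: infsumI)
qed

lemma subdiv_word_sum:
  assumes "\<And>\<eta>. is_mask (a \<eta>)"
  shows "subdiv_word a w (\<lambda>\<gamma>. \<Sum>\<beta>\<in>B. k \<beta> * d \<beta> \<gamma>) =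
    (\<lambda>\<alpha>. \<Sum>\<beta>\<in>B. k \<beta> * subdiv_word a w (d \<beta>) \<alpha>)"
proof (induction w arbitrary: d)
  case Nil
  show ?case by simp
next
  case (Cons \<eta> w)
  show ?case
    by (simp only: subdiv_word.simps subdiv_sum[of a \<eta> k d B, OF assms]
        Cons.IH[of "\<lambda>\<beta>. subdiv a \<eta> (d \<beta>)"])
qed

lemma subdiv_delta: "subdiv a \<eta> delta = a \<eta>"
proof
  fix \<alpha>
  have "subdiv a \<eta> delta \<alpha> = (\<Sum>\<^sub>\<infinity>\<beta>\<in>{0}. a \<eta> (\<alpha> - W \<eta> *v \<beta>) * delta \<beta>)"
    unfolding subdiv_def by (rule infsum_cong_neutral) (auto simp: delta_def)
  then show "subdiv a \<eta> delta \<alpha> = a \<eta> \<alpha>" by (simp add: delta_def)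
qed

text \<open>
  The discrete refinement equation: after its first step the scheme sees a combination of shifted
  deltas with the mask as coefficients.
\<close>

lemma subdiv_word_Cons_delta:
  assumes "\<And>\<eta>. is_mask (a \<eta>)"
  shows "subdiv_word a (\<eta> # w) delta \<alpha> =
    (\<Sum>\<beta> | a \<eta> \<beta> \<noteq> 0. a \<eta> \<beta> * subdiv_word a w delta (\<alpha> - W_word w *v \<beta>))"
proof -
  let ?B = "{\<beta>. a \<eta> \<beta> \<noteq> 0}"
  have "finite ?B" using assms[of \<eta>] by (simp add: is_mask_def)
  then have "(\<Sum>\<beta>\<in>?B. a \<eta> \<beta> * delta (\<gamma> - \<beta>)) = a \<eta> \<gamma>" for \<gamma>
    by (simp add: delta_def if_distrib[of "\<lambda>t. _ * t"] sum.delta cong: if_cong)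
  then have "subdiv_word a (\<eta> # w) delta =
      subdiv_word a w (\<lambda>\<gamma>. \<Sum>\<beta>\<in>?B. a \<eta> \<beta> * delta (\<gamma> - \<beta>))"
    by (simp add: subdiv_delta)
  also have "\<dots> = (\<lambda>\<alpha>. \<Sum>\<beta>\<in>?B. a \<eta> \<beta> * subdiv_word a w (\<lambda>\<gamma>. delta (\<gamma> - \<beta>)) \<alpha>)"
    by (rule subdiv_word_sum) (rule assms)
  finally show ?thesis by (simp only: subdiv_word_shift[of a w delta])
qed

section \<open>Passage to the limit\<close>

text \<open>
  Uniform convergence over the lattice means convergence along every sequence of lattice points.
  In this form it combines with limit theorems on the reals, and it covers the shifted points
  \<open>\<alpha> n - W\<^sub>w \<beta>\<close>, where the word \<open>w\<close>, and with it the shift, varies with \<open>n\<close>.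
\<close>

lemma limit_function_along:
  assumes "limit_function a \<epsilon> f"
  shows "(\<lambda>n. f (matrix_inv (W_word (stake n \<epsilon>)) *v real_vec (\<alpha> n))
              - subdiv_word a (stake n \<epsilon>) delta (\<alpha> n)) \<longlonglongrightarrow> 0"
    (is "?d \<longlonglongrightarrow> 0")
proof -
  have "(\<lambda>n. ereal \<bar>?d n\<bar>) \<longlonglongrightarrow> 0"
  proof (rule tendsto_sandwich[where f = "\<lambda>_. 0"])
    show "\<forall>\<^sub>F n in sequentially. ereal \<bar>?d n\<bar> \<le>
      (SUP \<alpha>. ereal \<bar>f (matrix_inv (W_word (stake n \<epsilon>)) *v real_vec \<alpha>)
                     - subdiv_word a (stake n \<epsilon>) delta \<alpha>\<bar>)"
      by (intro always_eventually allI SUP_upper2[OF UNIV_I order_refl])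
    show "(\<lambda>n. SUP \<alpha>. ereal \<bar>f (matrix_inv (W_word (stake n \<epsilon>)) *v real_vec \<alpha>)
                     - subdiv_word a (stake n \<epsilon>) delta \<alpha>\<bar>) \<longlonglongrightarrow> 0"
      using assms by (simp add: limit_function_def)
  qed simp_all
  then show ?thesis
    by (simp add: zero_ereal_def tendsto_rabs_zero_iff)
qed

theorem theorem4p6:
  fixes a :: "bit \<Rightarrow> int ^ 2 \<Rightarrow> real"
    and f :: "bit stream \<Rightarrow> real ^ 2 \<Rightarrow> real"
  assumes "is_mask (a 0)" and "is_mask (a 1)"
    and "scheme_converges a"
    and "\<And>\<epsilon>. limit_function a \<epsilon> (f \<epsilon>)"
  shows "\<forall>\<epsilon>. f \<epsilon> =
    (\<lambda>x. \<Sum>\<^sub>\<infinity>\<alpha>\<in>UNIV. a (shd \<epsilon>) \<alpha> * f (stl \<epsilon>) (W (shd \<epsilon>) *v x - real_vec \<alpha>))"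
proof (intro allI ext)
  fix \<epsilon> :: "bit stream" and x :: "real ^ 2"
  have mask: "is_mask (a \<eta>)" for \<eta>
    using assms(1,2) by (cases \<eta>) auto
  define \<eta> where "\<eta> = shd \<epsilon>"
  define B where "B = {\<beta>. a \<eta> \<beta> \<noteq> 0}"
  have fin: "finite B" using mask[of \<eta>] by (simp add: B_def is_mask_def)
  define g where "g = f (stl \<epsilon>)"
  define G where "G = (\<lambda>y. \<Sum>\<beta>\<in>B. a \<eta> \<beta> * g (W \<eta> *v y - real_vec \<beta>))"
  have cont: "isCont (f \<epsilon>') y" for \<epsilon>' y
    using assms(4)[of \<epsilon>'] by (auto simp: limit_function_def intro: isUCont_isCont)
  define w where "w n = stake n (stl \<epsilon>)" for n
  define \<alpha> where "\<alpha> = (\<lambda>n. floor_vec (W_word (stake (Suc n) \<epsilon>) *v x))"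
  define y where "y = (\<lambda>n. matrix_inv (W_word (stake (Suc n) \<epsilon>)) *v real_vec (\<alpha> n))"
  have stake: "stake (Suc n) \<epsilon> = \<eta> # w n" for n by (simp add: \<eta>_def w_def)
  have y: "y \<longlonglongrightarrow> x"
    using LIMSEQ_Suc[OF lattice_approximation[of \<epsilon> x]] by (simp only: y_def \<alpha>_def)

  \<comment> \<open>In the coordinates of the tail \<open>stl \<epsilon>\<close> the shift by \<open>W\<^sub>w \<beta>\<close> becomes the integer shift by \<open>\<beta>\<close>.\<close>
  have child_point: "matrix_inv (W_word (w n)) *v real_vec (\<alpha> n - W_word (w n) *v \<beta>) =
      W \<eta> *v y n - real_vec \<beta>" for n \<beta>
  proof -
    have "real_vec (\<alpha> n) = W_word (stake (Suc n) \<epsilon>) *v y n"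
      by (simp add: y_def matrix_vector_mul_assoc W_word_inverse del: stake.simps)
    also have "\<dots> = W_word (w n) *v (W \<eta> *v y n)"
      by (simp add: stake matrix_vector_mul_assoc del: stake.simps)
    finally have "real_vec (\<alpha> n - W_word (w n) *v \<beta>) = W_word (w n) *v (W \<eta> *v y n - real_vec \<beta>)"
      by (simp only: real_vec_diff real_vec_W_word matrix_vector_mult_diff_distrib)
    then show ?thesis
      by (simp only: matrix_vector_mul_assoc W_word_inverse matrix_vector_mul_lid)
  qed

  have "(\<lambda>n. f \<epsilon> (y n) - subdiv_word a (\<eta> # w n) delta (\<alpha> n)) \<longlonglongrightarrow> 0"
    \<comment> \<open>\<open>\<alpha> n\<close> belongs to the word of length \<open>n + 1\<close>, hence the shifted index.\<close>
    using LIMSEQ_Suc[OF limit_function_along[OF assms(4)[of \<epsilon>], of "\<lambda>n. \<alpha> (n - 1)"]]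
    by (simp only: stake y_def diff_Suc_1)
  moreover have "(\<lambda>n. \<Sum>\<beta>\<in>B. a \<eta> \<beta> * (g (W \<eta> *v y n - real_vec \<beta>)
      - subdiv_word a (w n) delta (\<alpha> n - W_word (w n) *v \<beta>))) \<longlonglongrightarrow> 0"
  proof (intro tendsto_null_sum tendsto_mult_right_zero)
    fix \<beta>
    show "(\<lambda>n. g (W \<eta> *v y n - real_vec \<beta>)
      - subdiv_word a (w n) delta (\<alpha> n - W_word (w n) *v \<beta>)) \<longlonglongrightarrow> 0"
      using limit_function_along[OF assms(4)[of "stl \<epsilon>"],
          of "\<lambda>n. \<alpha> n - W_word (w n) *v \<beta>", folded w_def g_def]
      by (simp only: child_point)
  qed
  ultimately have "(\<lambda>n. f \<epsilon> (y n) - subdiv_word a (\<eta> # w n) delta (\<alpha> n)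
      - (\<Sum>\<beta>\<in>B. a \<eta> \<beta> * (g (W \<eta> *v y n - real_vec \<beta>)
        - subdiv_word a (w n) delta (\<alpha> n - W_word (w n) *v \<beta>)))) \<longlonglongrightarrow> 0 - 0"
    by (rule tendsto_diff)
  \<comment> \<open>The discrete refinement equation cancels both approximating terms.\<close>
  then have "(\<lambda>n. f \<epsilon> (y n) - G (y n)) \<longlonglongrightarrow> 0"
    by (simp add: subdiv_word_Cons_delta mask right_diff_distrib sum_subtractf G_def B_def
        del: subdiv_word.simps)
  moreover have "(\<lambda>n. f \<epsilon> (y n) - G (y n)) \<longlonglongrightarrow> f \<epsilon> x - G x"
    unfolding G_def g_def
    by (intro tendsto_diff tendsto_sum tendsto_mult tendsto_const
        isCont_tendsto_compose[OF cont] y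
        bounded_linear.tendsto[OF matrix_vector_mul_bounded_linear])
  ultimately have "f \<epsilon> x = G x" using LIMSEQ_unique by fastforce
  also have "\<dots> = (\<Sum>\<^sub>\<infinity>\<beta>\<in>B. a \<eta> \<beta> * g (W \<eta> *v x - real_vec \<beta>))"
    using fin by (simp add: G_def)
  also have "\<dots> = (\<Sum>\<^sub>\<infinity>\<beta>\<in>UNIV. a \<eta> \<beta> * g (W \<eta> *v x - real_vec \<beta>))"
    by (rule infsum_cong_neutral) (auto simp: B_def)
  finally show "f \<epsilon> x =
    (\<Sum>\<^sub>\<infinity>\<alpha>\<in>UNIV. a (shd \<epsilon>) \<alpha> * f (stl \<epsilon>) (W (shd \<epsilon>) *v x - real_vec \<alpha>))"
    by (simp add: \<eta>_def g_def)
qed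

end
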